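(* Let $N\ge1$, let $\lambda$ be a partition of $N$ with conjugate partition $\lambda^t$, and let $D^{\lambda}$, $D^{\lambda^t}$ be the Young-Yamanouchi irreducible representations of the symmetric group $S(N)$, with orthonormal bases $\{|T\rangle\}$ indexed by standard Young tableaux of shape $\lambda$, respectively $\lambda^t$. Fix an arbitrarily chosen standard Young tableau $T^{\times}_\lambda$ of shape $\lambda$, and for every standard Young tableau $T_\lambda$ of shape $\lambda$ put $\operatorname{sgn}(T_\lambda)=\operatorname{sgn}(\sigma)$, where $\sigma\in S(N)$ is the unique permutation with $\sigma(T^\times_\lambda)=T_\lambda$. Then the operator $$U=\sum_{T_\lambda}\operatorname{sgn}(T_\lambda)\,|T_{\lambda^t}\rangle\langle T_\lambda|,$$ where the sum runs over all standard Young tableaux $T_\lambda$ of shape $\lambda$ and $T_{\lambda^t}$ denotes the conjugate (transposed) tableau of $T_\lambda$, is a unitary operator satisfying $$D^{\lambda^t}(\pi)=\operatorname{sgn}(\pi)\,U D^{\lambda}(\pi)U^{\dagger}\qquad\text{for all }\pi\in S(N).$$ For different choices of $T^\times_\lambda$ the corresponding operators $U$ may differ only by a global sign.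
   Context: A Young diagram of a partition $\lambda=(\lambda_1\ge\lambda_2\ge\cdots)$ of $N$ has $\lambda_i$ left-justified boxes in row $i$ (rows numbered from the top). A Young tableau of shape $\lambda$ is a bijective filling of the boxes with $1,\ldots,N$; it is standard if entries increase to the right along rows and downwards along columns. The conjugate partition $\lambda^t$ (and the conjugate tableau) is obtained by interchanging rows and columns (carrying along the entries). A permutation $\sigma\in S(N)$ acts on a Young tableau by replacing each entry $m$ with $\sigma(m)$. Axial distance: $\rho(T;i,j)$ is the signed number of horizontal and vertical steps to go from the box containing $i$ to the box containing $j$ in $T$, where each step down or to the left counts $+1$ and each step up or to the right counts $-1$. Young-Yamanouchi representation $D^\lambda$ of $S(N)$: the representation on the complex Hilbert space with orthonormal basis $\{|T\rangle : T \text{ a standard Young tableau of shape }\lambda\}$ determined on the generators $(k\ k+1)$, $k=1,\ldots,N-1$, by $$D^{\lambda}(k\ k+1)|T\rangle=\frac{1}{\rho(T;k+1,k)}|T\rangle+\sqrt{1-\frac{1}{\rho(T;k+1,k)^2}}\;|(k\ k+1)T\rangle,$$ where the second term appears only if $(k\ k+1)T$ is a standard Young tableau. It is a standard fact that this defines an irreducible unitary representation of $S(N)$. *)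

theory Defs
  imports
    Complex_Main
    "HOL-Library.Function_Algebras"
    "HOL-Combinatorics.Permutations"
    "HOL-Algebra.Group_Action"
    "HOL-Algebra.Sym_Groups"
begin

section \<open>Partitions, Young diagrams and standard tableaux\<close>

text \<open>A partition is its sequence of parts, padded with zeros. Rows and columns are
  numbered from 0, and the box \<open>(i, j)\<close> lies in row \<open>i\<close> (counted from the top) and
  column \<open>j\<close> (counted from the left).\<close>

definition partition_of :: "nat \<Rightarrow> (nat \<Rightarrow> nat) \<Rightarrow> bool" where
  "partition_of N lam \<longleftrightarrow>
     antimono lam \<and> finite {i. lam i \<noteq> 0} \<and> (\<Sum>i | lam i \<noteq> 0. lam i) = N"

definition diagram :: "(nat \<Rightarrow> nat) \<Rightarrow> (nat \<times> nat) set" where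
  "diagram lam = {(i, j). j < lam i}"

definition conjugate :: "(nat \<Rightarrow> nat) \<Rightarrow> nat \<Rightarrow> nat" where
  "conjugate lam j = card {i. j < lam i}"

lemma diagram_conjugate:
  assumes "partition_of N lam"
  shows "diagram (conjugate lam) = prod.swap ` diagram lam"
proof -
  have anti: "antimono lam" and fin: "finite {i. lam i \<noteq> 0}"
    using assms by (auto simp: partition_of_def)
  have "i < card {i. j < lam i} \<longleftrightarrow> j < lam i" for i j
  proof
    assume "j < lam i"
    then have "{..i} \<subseteq> {i. j < lam i}"
      using anti by (auto dest: antimonoD intro: less_le_trans)
    moreover have "finite {i. j < lam i}"
      by (rule finite_subset[OF _ fin]) auto
    ultimately have "card {..i} \<le> card {i. j < lam i}"
      by (rule card_mono[rotated])
    then show "i < card {i. j < lam i}" by simp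
  next
    assume *: "i < card {i. j < lam i}"
    show "j < lam i"
    proof (rule ccontr)
      assume n: "\<not> j < lam i"
      have "{i. j < lam i} \<subseteq> {..<i}"
      proof
        fix k assume "k \<in> {i. j < lam i}"
        then show "k \<in> {..<i}"
          using n antimonoD[OF anti, of i k] by (cases "k < i") auto
      qed
      then have "card {i. j < lam i} \<le> card {..<i}"
        by (intro card_mono) auto
      with * show False by simp
    qed
  qed
  then show ?thesis
    by (force simp: diagram_def conjugate_def image_iff)
qed

text \<open>A tableau takes the value 0, which is not an entry, outside the diagram. So a
  tableau is determined by its filling, the action of \<open>\<sigma>\<close> permuting \<open>{1..N}\<close> is
  \<open>\<sigma> \<circ> T\<close> (as \<open>\<sigma> 0 = 0\<close>), and the conjugate tableau is \<open>T \<circ> prod.swap\<close>.\<close>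

type_synonym tableau = "nat \<times> nat \<Rightarrow> nat"

definition young_tableau :: "nat \<Rightarrow> (nat \<Rightarrow> nat) \<Rightarrow> tableau \<Rightarrow> bool" where
  "young_tableau N lam T \<longleftrightarrow>
     bij_betw T (diagram lam) {1..N} \<and> (\<forall>b. b \<notin> diagram lam \<longrightarrow> T b = 0)"

definition SYT :: "nat \<Rightarrow> (nat \<Rightarrow> nat) \<Rightarrow> tableau set" where
  "SYT N lam = {T. young_tableau N lam T \<and>
     (\<forall>i j j'. j < j' \<and> (i, j') \<in> diagram lam \<longrightarrow> T (i, j) < T (i, j')) \<and>
     (\<forall>i i' j. i < i' \<and> (i', j) \<in> diagram lam \<longrightarrow> T (i, j) < T (i', j))}"

definition conj_tab :: "tableau \<Rightarrow> tableau" where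
  "conj_tab T = T \<circ> prod.swap"

definition box :: "tableau \<Rightarrow> nat \<Rightarrow> nat \<times> nat" where
  "box T m = (THE b. T b = m)"

text \<open>Steps down and to the left count \<open>+1\<close>, steps up and to the right \<open>-1\<close>.\<close>

definition axial_distance :: "tableau \<Rightarrow> nat \<Rightarrow> nat \<Rightarrow> int" where
  "axial_distance T i j =
     (int (fst (box T j)) - int (fst (box T i))) + (int (snd (box T i)) - int (snd (box T j)))"

definition tab_sign :: "nat \<Rightarrow> tableau \<Rightarrow> tableau \<Rightarrow> int" where
  "tab_sign N T0 T = sign (THE \<sigma>. \<sigma> permutes {1..N} \<and> \<sigma> \<circ> T0 = T)"


section \<open>The Hilbert space with orthonormal basis \<open>B\<close>\<close>

text \<open>For a finite set \<open>B\<close>, the complex Hilbert space with orthonormal basis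
  \<open>{ket b | b \<in> B}\<close> consists of the functions vanishing outside \<open>B\<close>. The inner product is
  antilinear in the first argument. An operator is a function on vectors; only
  its values on the space in question matter.\<close>

definition hspace :: "'a set \<Rightarrow> ('a \<Rightarrow> complex) set" where
  "hspace B = {v. \<forall>b. b \<notin> B \<longrightarrow> v b = 0}"

definition cscale :: "complex \<Rightarrow> ('a \<Rightarrow> complex) \<Rightarrow> 'a \<Rightarrow> complex" (infixr "*\<^sub>c" 75) where
  "c *\<^sub>c v = (\<lambda>b. c * v b)"

definition ket :: "'a \<Rightarrow> 'a \<Rightarrow> complex" where
  "ket b = (\<lambda>b'. if b' = b then 1 else 0)"

definition braket :: "'a set \<Rightarrow> ('a \<Rightarrow> complex) \<Rightarrow> ('a \<Rightarrow> complex) \<Rightarrow> complex" where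
  "braket B v w = (\<Sum>b\<in>B. cnj (v b) * w b)"

definition linear_op ::
  "'a set \<Rightarrow> 'b set \<Rightarrow> (('a \<Rightarrow> complex) \<Rightarrow> 'b \<Rightarrow> complex) \<Rightarrow> bool" where
  "linear_op B C A \<longleftrightarrow>
     A \<in> hspace B \<rightarrow> hspace C \<and>
     (\<forall>v\<in>hspace B. \<forall>w\<in>hspace B. A (v + w) = A v + A w) \<and>
     (\<forall>c. \<forall>v\<in>hspace B. A (c *\<^sub>c v) = c *\<^sub>c A v)"

definition adjoint_op ::
  "'a set \<Rightarrow> 'b set \<Rightarrow> (('a \<Rightarrow> complex) \<Rightarrow> 'b \<Rightarrow> complex) \<Rightarrow> ('b \<Rightarrow> complex) \<Rightarrow> 'a \<Rightarrow> complex" where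
  "adjoint_op B C A = (SOME A'. A' \<in> hspace C \<rightarrow> hspace B \<and>
     (\<forall>v\<in>hspace B. \<forall>w\<in>hspace C. braket B (A' w) v = braket C w (A v)))"

definition unitary_op ::
  "'a set \<Rightarrow> 'b set \<Rightarrow> (('a \<Rightarrow> complex) \<Rightarrow> 'b \<Rightarrow> complex) \<Rightarrow> bool" where
  "unitary_op B C A \<longleftrightarrow>
     linear_op B C A \<and>
     (\<forall>v\<in>hspace B. adjoint_op B C A (A v) = v) \<and>
     (\<forall>w\<in>hspace C. A (adjoint_op B C A w) = w)"

text \<open>The operator \<open>|c\<rangle>\<langle>b|\<close>, where \<open>b\<close> belongs to the basis \<open>B\<close>.\<close>

definition ketbra :: "'a set \<Rightarrow> 'b \<Rightarrow> 'a \<Rightarrow> ('a \<Rightarrow> complex) \<Rightarrow> 'b \<Rightarrow> complex" where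
  "ketbra B c b v = braket B (ket b) v *\<^sub>c ket c"


section \<open>The Young-Yamanouchi representation\<close>

text \<open>A representation on \<open>hspace B\<close> is a group action by linear maps. Since adjacent
  transpositions generate the symmetric group and the maps of a group action are
  extensional, at most one \<open>D\<close> (up to its values off the group) satisfies
  \<open>young_yamanouchi N lam D\<close>.\<close>

definition linear_rep ::
  "nat \<Rightarrow> 'a set \<Rightarrow> ((nat \<Rightarrow> nat) \<Rightarrow> ('a \<Rightarrow> complex) \<Rightarrow> 'a \<Rightarrow> complex) \<Rightarrow> bool" where
  "linear_rep N B D \<longleftrightarrow>
     group_action (sym_group N) (hspace B) D \<and>
     (\<forall>\<pi>\<in>carrier (sym_group N). linear_op B B (D \<pi>))"

definition young_yamanouchi ::
  "nat \<Rightarrow> (nat \<Rightarrow> nat) \<Rightarrow> ((nat \<Rightarrow> nat) \<Rightarrow> (tableau \<Rightarrow> complex) \<Rightarrow> tableau \<Rightarrow> complex) \<Rightarrow> bool" where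
  "young_yamanouchi N lam D \<longleftrightarrow>
     linear_rep N (SYT N lam) D \<and>
     (\<forall>k T. 1 \<le> k \<and> k < N \<and> T \<in> SYT N lam \<longrightarrow>
        (let s = Transposition.transpose k (k + 1);
             r = real_of_int (axial_distance T (k + 1) k)
         in D s (ket T) =
              complex_of_real (1 / r) *\<^sub>c ket T +
              (if s \<circ> T \<in> SYT N lam
               then complex_of_real (sqrt (1 - 1 / r\<^sup>2)) *\<^sub>c ket (s \<circ> T) else 0)))"

definition conj_op ::
  "nat \<Rightarrow> (nat \<Rightarrow> nat) \<Rightarrow> tableau \<Rightarrow> (tableau \<Rightarrow> complex) \<Rightarrow> tableau \<Rightarrow> complex" where
  "conj_op N lam T0 v =
     (\<Sum>T\<in>SYT N lam. of_int (tab_sign N T0 T) *\<^sub>c ketbra (SYT N lam) (conj_tab T) T v)"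

end

(*
  Transposing a tableau negates all axial distances, so on the basis vector of the transposed
  tableau the diagonal coefficient of an adjacent transposition changes sign and the off-diagonal
  one does not. The signs in U repair this: an adjacent transposition flips the sign of a tableau.
  Hence D' s U = - U D s for every adjacent transposition s, and these generate the group.
*)
theory Submission
  imports Defs
begin

section \<open>Adjacent transpositions\<close>

text \<open>Permutations of a finite set arise from \<open>id\<close> by multiplying transpositions
  on the left, and each transposition is itself a word in adjacent ones. The new factor stands on
  the left, so that a homomorphism splits it off as the outer operator.\<close>

lemma permutes_adjacent_induct [consumes 1, case_names id adj]:
  fixes N :: nat
  assumes "p permutes {1..N}"
    and "P id"
    and adj: "\<And>k q. 1 \<le> k \<Longrightarrow> k < N \<Longrightarrow> q permutes {1..N} \<Longrightarrow> P q \<Longrightarrow>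
           P (Transposition.transpose k (k + 1) \<circ> q)"
  shows "P p"
proof -
  have adjs: "P (apply_adj_transps xs \<circ> q)"
    if "set xs \<subseteq> {1..<N}" "q permutes {1..N}" "P q" for xs q
    using that(1)
  proof (induction xs)
    case Nil
    show ?case using that(3) by simp
  next
    case (Cons x xs)
    have "apply_adj_transps xs \<circ> q permutes {1..N}"
      using Cons.prems that(2)
      by (intro permutes_compose[OF that(2)] permutes_apply_adj_transps) auto
    with Cons adj[of x "apply_adj_transps xs \<circ> q"]
    have "P (Transposition.transpose x (x + 1) \<circ> (apply_adj_transps xs \<circ> q))"
      by (auto simp: comp_def)
    then show ?case by (metis apply_adj_transps_Cons comp_assoc)
  qed
  \<comment> \<open>The word \<open>adj_transp_seq a b\<close> spells the transposition of
    \<open>a < b\<close> in adjacent transpositions that stay inside \<open>{1..N}\<close>.\<close>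
  have step: "P (Transposition.transpose a b \<circ> q)"
    if "a \<in> {1..N}" "b \<in> {1..N}" "a < b" "P q" "q permutes {1..N}" for a b q
    using adjs[of "adj_transp_seq a b" q] that
    by (auto simp: set_adj_transp_seq adj_transp_seq_correct)
  show ?thesis
    using assms(1) finite_atLeastAtMost assms(2)
  proof (induction rule: permutes_induct)
    case (swap a b q)
    then consider "a < b" | "b < a" by linarith
    then show ?case
    proof cases
      case 1
      then show ?thesis using swap by (intro step)
    next
      case 2
      then show ?thesis using swap by (subst transpose_commute, intro step)
    qed
  qed
qed


section \<open>Operators on finite-dimensional Hilbert spaces\<close>

lemma sum_fun_apply: "(\<Sum>x\<in>A. f x) b = (\<Sum>x\<in>A. f x b)"
  by (induction A rule: infinite_finite_induct) auto

lemma ket_in_hspace: "b \<in> B \<Longrightarrow> ket b \<in> hspace B"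
  by (auto simp: ket_def hspace_def)

lemma hspace_add: "v \<in> hspace B \<Longrightarrow> w \<in> hspace B \<Longrightarrow> v + w \<in> hspace B"
  by (auto simp: hspace_def)

lemma hspace_cscale: "v \<in> hspace B \<Longrightarrow> c *\<^sub>c v \<in> hspace B"
  by (auto simp: hspace_def cscale_def)

lemma braket_ket:
  assumes "finite B" "b \<in> B"
  shows "braket B v (ket b) = cnj (v b)" "braket B (ket b) v = v b"
proof -
  have "braket B v (ket b) = (\<Sum>b'\<in>B. if b' = b then cnj (v b') else 0)"
    unfolding braket_def ket_def by (rule sum.cong) auto
  then show "braket B v (ket b) = cnj (v b)" using assms by simp
  have "braket B (ket b) v = (\<Sum>b'\<in>B. if b' = b then v b' else 0)"
    unfolding braket_def ket_def by (rule sum.cong) auto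
  then show "braket B (ket b) v = v b" using assms by simp
qed

lemma hspace_eq_sum_ket:
  assumes "finite B" "v \<in> hspace B"
  shows "v = (\<Sum>b\<in>B. v b *\<^sub>c ket b)"
proof
  fix b
  have "(\<Sum>b'\<in>B. v b' *\<^sub>c ket b') b = (\<Sum>b'\<in>B. if b' = b then v b' else 0)"
    unfolding sum_fun_apply by (rule sum.cong) (auto simp: cscale_def ket_def)
  then show "v b = (\<Sum>b'\<in>B. v b' *\<^sub>c ket b') b"
    using assms by (auto simp: hspace_def)
qed

section \<open>Linear maps and their values on basis vectors\<close>

lemma linear_op_add:
  "linear_op B C A \<Longrightarrow> v \<in> hspace B \<Longrightarrow> w \<in> hspace B \<Longrightarrow> A (v + w) = A v + A w"
  by (auto simp: linear_op_def)

lemma linear_op_cscale: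
  "linear_op B C A \<Longrightarrow> v \<in> hspace B \<Longrightarrow> A (c *\<^sub>c v) = c *\<^sub>c A v"
  by (auto simp: linear_op_def)

lemma linear_op_zero:
  assumes "linear_op B C A"
  shows "A 0 = 0"
proof -
  have "A (0 *\<^sub>c 0) = 0 *\<^sub>c A 0"
    using assms by (rule linear_op_cscale) (auto simp: hspace_def)
  then show ?thesis by (simp add: cscale_def zero_fun_def)
qed

text \<open>Membership of the partial sums is carried through the induction because additivity of
  \<open>A\<close> is available only for vectors of \<open>hspace B\<close>.\<close>

lemma linear_op_sum_ket:
  assumes "linear_op B C A" "finite F" "F \<subseteq> B"
  shows "(\<Sum>b\<in>F. c b *\<^sub>c ket b) \<in> hspace B \<and>
    A (\<Sum>b\<in>F. c b *\<^sub>c ket b) = (\<Sum>b\<in>F. c b *\<^sub>c A (ket b))"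
  using assms(2,3)
proof (induction F)
  case empty
  show ?case using linear_op_zero[OF assms(1)] by (simp add: hspace_def zero_fun_def)
next
  case (insert b F)
  then have b: "ket b \<in> hspace B" and IH: "(\<Sum>b\<in>F. c b *\<^sub>c ket b) \<in> hspace B"
      "A (\<Sum>b\<in>F. c b *\<^sub>c ket b) = (\<Sum>b\<in>F. c b *\<^sub>c A (ket b))"
    by (auto intro: ket_in_hspace)
  have "A (c b *\<^sub>c ket b + (\<Sum>b\<in>F. c b *\<^sub>c ket b)) = c b *\<^sub>c A (ket b) + (\<Sum>b\<in>F. c b *\<^sub>c A (ket b))"
    unfolding linear_op_add[OF assms(1) hspace_cscale[OF b] IH(1)]
      linear_op_cscale[OF assms(1) b] IH(2) ..
  then show ?case
    unfolding sum.insert[OF insert.hyps(1,2)]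
    using hspace_add[OF hspace_cscale[OF b] IH(1)] by blast
qed

text \<open>Reduces the intertwining relation to tableau kets, the only vectors on which the
  Young-Yamanouchi formula speaks. Finiteness of \<open>B\<close> makes every vector a finite
  combination of kets.\<close>

lemma linear_op_eqI:
  assumes "finite B" "linear_op B C A" "linear_op B C A'"
    and "\<And>b. b \<in> B \<Longrightarrow> A (ket b) = A' (ket b)" and "v \<in> hspace B"
  shows "A v = A' v"
proof -
  have "A v = A (\<Sum>b\<in>B. v b *\<^sub>c ket b)"
    using hspace_eq_sum_ket[OF assms(1,5)] by simp
  also have "\<dots> = (\<Sum>b\<in>B. v b *\<^sub>c A (ket b))"
    using linear_op_sum_ket[OF assms(2,1)] by blast
  also have "\<dots> = (\<Sum>b\<in>B. v b *\<^sub>c A' (ket b))"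
    using assms(4) by (intro sum.cong) auto
  also have "\<dots> = A' (\<Sum>b\<in>B. v b *\<^sub>c ket b)"
    using linear_op_sum_ket[OF assms(3,1)] by (metis order_refl)
  also have "\<dots> = A' v"
    using hspace_eq_sum_ket[OF assms(1,5)] by simp
  finally show ?thesis .
qed

lemma linear_op_compose:
  "linear_op B C A \<Longrightarrow> linear_op C E A' \<Longrightarrow> linear_op B E (\<lambda>v. A' (A v))"
  by (auto simp: linear_op_def Pi_iff)

lemma linear_op_scaled:
  assumes "linear_op B C A"
  shows "linear_op B C (\<lambda>v. c *\<^sub>c A v)"
  using assms unfolding linear_op_def
  by (auto simp: Pi_iff hspace_cscale) (auto simp: cscale_def algebra_simps)

section \<open>Adjoints and unitarity of monomial operators\<close>

text \<open>Since \<open>adjoint_op\<close> is obtained by choice, a candidate \<open>A'\<close> is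
  what shows that the chosen object has the adjoint property. Uniqueness on \<open>hspace C\<close>
  then follows by pairing with basis vectors, which reads off coordinates.\<close>

lemma adjoint_op_eqI:
  assumes fin: "finite B" and A': "A' \<in> hspace C \<rightarrow> hspace B"
    and adj: "\<And>v w. v \<in> hspace B \<Longrightarrow> w \<in> hspace C \<Longrightarrow> braket B (A' w) v = braket C w (A v)"
    and w: "w \<in> hspace C"
  shows "adjoint_op B C A w = A' w"
proof -
  let ?Q = "\<lambda>A'. A' \<in> hspace C \<rightarrow> hspace B \<and>
     (\<forall>v\<in>hspace B. \<forall>w\<in>hspace C. braket B (A' w) v = braket C w (A v))"
  have "?Q (adjoint_op B C A)"
    unfolding adjoint_op_def by (rule someI[of ?Q A']) (use A' adj in blast)
  then have in_B: "adjoint_op B C A w \<in> hspace B"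
    and eq: "\<And>v. v \<in> hspace B \<Longrightarrow> braket B (adjoint_op B C A w) v = braket B (A' w) v"
    using w adj by auto
  show ?thesis
  proof
    fix b
    show "adjoint_op B C A w b = A' w b"
    proof (cases "b \<in> B")
      case True
      then show ?thesis
        using eq[OF ket_in_hspace[OF True]] braket_ket(1)[OF fin True] by simp
    next
      case False
      then show ?thesis using in_B A' w by (auto simp: hspace_def Pi_iff)
    qed
  qed
qed

text \<open>Such an \<open>A\<close> relabels the basis by \<open>g\<close> and multiplies by phases
  \<open>e b\<close>, so undoing the relabelling with conjugate phases gives both adjoint and
  inverse. The range of the adjoint is recorded as well, because the conjugation formula later
  applies \<open>D\<close> to adjoint images.\<close>

lemma unitary_op_monomial:
  assumes fin: "finite B" and g: "bij_betw g B C"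
    and unit: "\<And>b. b \<in> B \<Longrightarrow> cnj (e b) * e b = 1"
    and AC: "\<And>v. v \<in> hspace B \<Longrightarrow> A v \<in> hspace C"
    and A: "\<And>v b. v \<in> hspace B \<Longrightarrow> b \<in> B \<Longrightarrow> A v (g b) = e b * v b"
  shows "unitary_op B C A \<and> adjoint_op B C A \<in> hspace C \<rightarrow> hspace B"
proof -
  have C: "C = g ` B" using g by (simp add: bij_betw_def)
  \<comment> \<open>The explicit adjoint. Its value 0 outside \<open>B\<close> keeps it in
    \<open>hspace B\<close>.\<close>
  define A' where "A' = (\<lambda>(w :: 'b \<Rightarrow> complex) b. if b \<in> B then cnj (e b) * w (g b) else 0)"
  have A'B: "A' w \<in> hspace B" for w
    by (auto simp: A'_def hspace_def)
  \<comment> \<open>As \<open>g\<close> is onto \<open>C\<close>, a vector of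
    \<open>hspace C\<close> is determined by its coordinates at the labels
    \<open>g b\<close>.\<close>
  have eqC: "v = w" if "v \<in> hspace C" "w \<in> hspace C" "\<And>b. b \<in> B \<Longrightarrow> v (g b) = w (g b)"
    for v w :: "'b \<Rightarrow> complex"
  proof
    fix c show "v c = w c" using that by (cases "c \<in> C") (auto simp: C hspace_def)
  qed
  have lin: "linear_op B C A"
    unfolding linear_op_def
  proof (intro conjI ballI allI)
    show "A \<in> hspace B \<rightarrow> hspace C" using AC by auto
  next
    fix v w assume "v \<in> hspace B" "w \<in> hspace B"
    then show "A (v + w) = A v + A w"
      by (intro eqC) (auto simp: A AC hspace_add algebra_simps)
  next
    fix c v assume "v \<in> hspace B"
    then show "A (c *\<^sub>c v) = c *\<^sub>c A v"
      by (intro eqC) (auto simp: A AC hspace_cscale, auto simp: cscale_def A)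
  qed
  have adj: "adjoint_op B C A w = A' w" if "w \<in> hspace C" for w
  proof (rule adjoint_op_eqI[OF fin _ _ that])
    show "A' \<in> hspace C \<rightarrow> hspace B" using A'B by blast
    fix v w assume "v \<in> hspace B" "w \<in> hspace C"
    have "braket C w (A v) = (\<Sum>b\<in>B. cnj (w (g b)) * A v (g b))"
      unfolding braket_def by (rule sum.reindex_bij_betw[OF g, symmetric])
    also have "\<dots> = braket B (A' w) v"
      unfolding braket_def using \<open>v \<in> hspace B\<close>
      by (intro sum.cong) (auto simp: A A'_def algebra_simps)
    finally show "braket B (A' w) v = braket C w (A v)" ..
  qed
  have "A' (A v) = v" if "v \<in> hspace B" for v
  proof
    fix b show "A' (A v) b = v b"
      using that unit[of b] by (auto simp: A'_def A hspace_def mult.assoc[symmetric])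
  qed
  moreover have "A (A' w) = w" if "w \<in> hspace C" for w
  proof (rule eqC)
    fix b assume "b \<in> B"
    then have "A (A' w) (g b) = (cnj (e b) * e b) * w (g b)"
      using A[OF A'B, of b] by (simp add: A'_def)
    then show "A (A' w) (g b) = w (g b)" using unit \<open>b \<in> B\<close> by simp
  qed (use that AC A'B in auto)
  ultimately show ?thesis
    using lin adj AC A'B by (simp add: unitary_op_def Pi_iff)
qed


section \<open>Tableaux\<close>

lemma finite_diagram:
  assumes "partition_of N lam"
  shows "finite (diagram lam)"
proof -
  have "diagram lam \<subseteq> (SIGMA i : {i. lam i \<noteq> 0}. {..<lam i})"
    by (auto simp: diagram_def)
  then show ?thesis
    using assms by (auto simp: partition_of_def intro: finite_subset)
qed

lemma SYT_bij_betw: "T \<in> SYT N lam \<Longrightarrow> bij_betw T (diagram lam) {1..N}"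
  by (simp add: SYT_def young_tableau_def)

lemma SYT_outside: "T \<in> SYT N lam \<Longrightarrow> b \<notin> diagram lam \<Longrightarrow> T b = 0"
  unfolding SYT_def young_tableau_def by blast

text \<open>A tableau is a map from a finite diagram to \<open>{1..N}\<close>, extended by the fixed
  value 0, and there are finitely many of these.\<close>

lemma finite_SYT:
  assumes "partition_of N lam"
  shows "finite (SYT N lam)"
proof (rule finite_subset)
  show "SYT N lam \<subseteq> {T. \<forall>b. (b \<in> diagram lam \<longrightarrow> T b \<in> {1..N}) \<and> (b \<notin> diagram lam \<longrightarrow> T b = 0)}"
    by (auto simp: SYT_def young_tableau_def bij_betw_def)
  show "finite {T. \<forall>b. (b \<in> diagram lam \<longrightarrow> T b \<in> {1..N}) \<and> (b \<notin> diagram lam \<longrightarrow> T b = (0::nat))}"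
    using finite_diagram[OF assms] by (intro finite_set_of_finite_funs) auto
qed

section \<open>Conjugate tableaux and axial distances\<close>

text \<open>Swapping coordinates exchanges the row and the column condition. The assumption relates
  diagrams instead of naming \<open>conjugate\<close>, so the lemma can be applied in both
  directions, the swap being an involution.\<close>

lemma conj_tab_SYT:
  assumes mu: "diagram mu = prod.swap ` diagram lam" and T: "T \<in> SYT N lam"
  shows "conj_tab T \<in> SYT N mu"
proof -
  have mem: "(i, j) \<in> diagram mu \<longleftrightarrow> (j, i) \<in> diagram lam" for i j
    unfolding mu by force
  have "bij_betw prod.swap (diagram mu) (diagram lam)"
    unfolding mu by (auto simp: bij_betw_def inj_on_def image_image)
  moreover have "bij_betw T (diagram lam) {1..N}"
    using T by (auto simp: SYT_def young_tableau_def)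
  ultimately have "bij_betw (T \<circ> prod.swap) (diagram mu) {1..N}"
    by (rule bij_betw_trans)
  then show ?thesis
    using T by (auto simp: SYT_def young_tableau_def conj_tab_def mem)
qed

lemma conj_tab_conj_tab [simp]: "conj_tab (conj_tab T) = T"
  by (auto simp: conj_tab_def)

lemma bij_betw_conj_tab:
  assumes mu: "diagram mu = prod.swap ` diagram lam"
  shows "bij_betw conj_tab (SYT N lam) (SYT N mu)"
proof (rule bij_betw_byWitness[where f' = conj_tab])
  have "diagram lam = prod.swap ` diagram mu"
    unfolding mu by (auto simp: image_image)
  then show "conj_tab ` SYT N mu \<subseteq> SYT N lam" by (auto intro: conj_tab_SYT)
qed (auto intro: conj_tab_SYT[OF mu])

lemma conj_tab_comp: "conj_tab (f \<circ> T) = f \<circ> conj_tab T"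
  by (simp add: conj_tab_def comp_assoc)

lemma box_conj_tab:
  assumes "T \<in> SYT N lam" "m \<in> {1..N}"
  shows "box (conj_tab T) m = prod.swap (box T m)"
proof -
  have bij: "bij_betw T (diagram lam) {1..N}" using assms(1) by (rule SYT_bij_betw)
  have "m \<in> T ` diagram lam"
    using bij_betw_imp_surj_on[OF bij] assms(2) by (simp only:)
  then obtain b where b: "b \<in> diagram lam" "T b = m"
    by (elim imageE) simp
  \<comment> \<open>Entries are at least 1, while \<open>T\<close> is 0 outside the diagram. Hence a
    box containing \<open>m\<close> lies in the diagram, where \<open>T\<close> is
    injective.\<close>
  have uniq: "b' = b" if "T b' = m" for b'
  proof -
    have "b' \<in> diagram lam"
      using SYT_outside[OF assms(1), of b'] that assms(2) by fastforce
    then show ?thesis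
      using bij_betw_imp_inj_on[OF bij] b that by (auto dest: inj_onD)
  qed
  have "box T m = b"
    unfolding box_def using b(2) uniq by (rule the_equality)
  moreover have "box (conj_tab T) m = prod.swap b"
    unfolding box_def
  proof (rule the_equality)
    show "conj_tab T (prod.swap b) = m" using b by (simp add: conj_tab_def)
    fix b' assume "conj_tab T b' = m"
    then have "prod.swap b' = b" using uniq by (simp add: conj_tab_def)
    then show "b' = prod.swap b" by auto
  qed
  ultimately show ?thesis by simp
qed

text \<open>Reflection turns steps down into steps right and steps left into steps up, so every step
  changes its sign.\<close>

lemma axial_distance_conj_tab:
  assumes "T \<in> SYT N lam" "i \<in> {1..N}" "j \<in> {1..N}"
  shows "axial_distance (conj_tab T) i j = - axial_distance T i j"
  using assms by (simp add: axial_distance_def box_conj_tab)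

section \<open>Signs of tableaux\<close>

text \<open>Justifies the definite description in \<open>tab_sign\<close>: the permutation is forced
  on \<open>{1..N}\<close>, which \<open>T0\<close> covers, and is the identity elsewhere.\<close>

lemma tab_sign_permutes:
  assumes "T0 \<in> SYT N lam" "\<sigma> permutes {1..N}" "\<sigma> \<circ> T0 = T"
  shows "tab_sign N T0 T = sign \<sigma>"
proof -
  have "(THE \<sigma>. \<sigma> permutes {1..N} \<and> \<sigma> \<circ> T0 = T) = \<sigma>"
  proof (rule the_equality)
    fix \<tau> assume \<tau>: "\<tau> permutes {1..N} \<and> \<tau> \<circ> T0 = T"
    have range: "{1..N} \<subseteq> range T0"
      using bij_betw_imp_surj_on[OF SYT_bij_betw[OF assms(1)]] by blast
    show "\<tau> = \<sigma>"
    proof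
      fix m show "\<tau> m = \<sigma> m"
      proof (cases "m \<in> {1..N}")
        case True
        then obtain b where "m = T0 b" using range by blast
        then show ?thesis using \<tau> assms(3) by (metis comp_apply)
      next
        case False
        then show ?thesis using \<tau> assms(2) by (metis permutes_not_in)
      qed
    qed
  qed (use assms in auto)
  then show ?thesis by (simp add: tab_sign_def)
qed

lemma SYT_permutation_exists:
  assumes T0: "T0 \<in> SYT N lam" and T: "T \<in> SYT N lam"
  obtains \<sigma> where "\<sigma> permutes {1..N}" "\<sigma> \<circ> T0 = T"
proof -
  let ?D = "diagram lam"
  have b0: "bij_betw T0 ?D {1..N}" and b: "bij_betw T ?D {1..N}"
    using T0 T by (simp_all only: SYT_bij_betw)
  \<comment> \<open>This is \<open>T\<close> after the inverse of \<open>T0\<close>, extended by the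
    identity. In particular it fixes 0, which gives agreement outside the diagram too.\<close>
  define \<sigma> where "\<sigma> m = (if m \<in> {1..N} then T (inv_into ?D T0 m) else m)" for m
  have "bij_betw (T \<circ> inv_into ?D T0) {1..N} {1..N}"
    using bij_betw_inv_into[OF b0] b by (rule bij_betw_trans)
  then have "bij_betw \<sigma> {1..N} {1..N}"
    by (subst bij_betw_cong[where g = "T \<circ> inv_into ?D T0"]) (auto simp: \<sigma>_def)
  then have "\<sigma> permutes {1..N}"
    by (rule bij_imp_permutes) (auto simp: \<sigma>_def)
  moreover have "\<sigma> \<circ> T0 = T"
  proof
    fix x show "(\<sigma> \<circ> T0) x = T x"
    proof (cases "x \<in> ?D")
      case True
      then have "T0 x \<in> {1..N}" using b0 by (auto simp: bij_betw_def)
      then show ?thesis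
        using True b0 by (simp add: \<sigma>_def bij_betw_def)
    next
      case False
      then have "T0 x = 0" "T x = 0"
        using T0 T by (auto simp: SYT_outside)
      then show ?thesis by (simp add: \<sigma>_def)
    qed
  qed
  ultimately show ?thesis by (rule that)
qed

text \<open>If \<sigma> carries \<open>T0\<close> to \<open>T\<close>, then
  \<open>\<tau> \<circ> \<sigma>\<close> carries \<open>T0\<close> to
  \<open>\<tau> \<circ> T\<close>, and signs multiply. The tableau \<open>\<tau> \<circ> T\<close>
  may fail to be standard.\<close>

lemma tab_sign_comp:
  assumes "T0 \<in> SYT N lam" "T \<in> SYT N lam" "\<tau> permutes {1..N}"
  shows "tab_sign N T0 (\<tau> \<circ> T) = sign \<tau> * tab_sign N T0 T"
proof -
  obtain \<sigma> where \<sigma>: "\<sigma> permutes {1..N}" "\<sigma> \<circ> T0 = T"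
    using SYT_permutation_exists[OF assms(1,2)] by blast
  have "tab_sign N T0 (\<tau> \<circ> T) = sign (\<tau> \<circ> \<sigma>)"
    using assms \<sigma> by (intro tab_sign_permutes) (auto intro: permutes_compose)
  also have "\<dots> = sign \<tau> * sign \<sigma>"
    using assms(3) \<sigma>(1) by (intro sign_compose) (auto intro: permutes_imp_permutation)
  also have "sign \<sigma> = tab_sign N T0 T"
    using tab_sign_permutes[OF assms(1) \<sigma>] by simp
  finally show ?thesis .
qed

text \<open>The permutation from \<open>T1\<close> to \<open>T\<close> factors through
  \<open>T0\<close>. The factor comparing the two base tableaux is therefore the same for all
  \<open>T\<close>, which yields the global sign.\<close>

lemma tab_sign_change_base:
  assumes "T0 \<in> SYT N lam" "T1 \<in> SYT N lam" "T \<in> SYT N lam"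
  shows "tab_sign N T1 T = tab_sign N T1 T0 * tab_sign N T0 T"
proof -
  obtain \<sigma> where \<sigma>: "\<sigma> permutes {1..N}" "\<sigma> \<circ> T0 = T"
    using SYT_permutation_exists[OF assms(1,3)] by blast
  show ?thesis
    using tab_sign_comp[OF assms(2,1) \<sigma>(1)] tab_sign_permutes[OF assms(1) \<sigma>] \<sigma>(2) by simp
qed


section \<open>The conjugation operator\<close>

lemma conj_op_apply:
  assumes "finite (SYT N lam)"
  shows "conj_op N lam T0 v b =
    (\<Sum>T\<in>SYT N lam. if b = conj_tab T then of_int (tab_sign N T0 T) * v T else 0)"
proof -
  have "conj_op N lam T0 v b =
      (\<Sum>T\<in>SYT N lam. (of_int (tab_sign N T0 T) *\<^sub>c ketbra (SYT N lam) (conj_tab T) T v) b)"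
    unfolding conj_op_def by (rule sum_fun_apply)
  also have "\<dots> = (\<Sum>T\<in>SYT N lam. if b = conj_tab T then of_int (tab_sign N T0 T) * v T else 0)"
  proof (rule sum.cong[OF refl])
    fix T assume "T \<in> SYT N lam"
    then have "braket (SYT N lam) (ket T) v = v T" by (rule braket_ket(2)[OF assms])
    then show "(of_int (tab_sign N T0 T) *\<^sub>c ketbra (SYT N lam) (conj_tab T) T v) b =
        (if b = conj_tab T then of_int (tab_sign N T0 T) * v T else 0)"
      by (simp add: cscale_def ketbra_def ket_def)
  qed
  finally show ?thesis .
qed

text \<open>Exhibits \<open>conj_op\<close> as a monomial operator with relabelling
  \<open>conj_tab\<close> and phases \<open>tab_sign\<close>. Injectivity of \<open>conj_tab\<close>
  leaves a single summand.\<close>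

lemma conj_op_conj_tab:
  assumes "finite (SYT N lam)" "T \<in> SYT N lam"
  shows "conj_op N lam T0 v (conj_tab T) = of_int (tab_sign N T0 T) * v T"
proof -
  have "conj_tab T = conj_tab T' \<longleftrightarrow> T = T'" for T'
    using conj_tab_conj_tab by metis
  then show ?thesis using assms by (simp add: conj_op_apply)
qed

lemma conj_op_in_hspace:
  assumes "finite (SYT N lam)" "diagram mu = prod.swap ` diagram lam"
  shows "conj_op N lam T0 v \<in> hspace (SYT N mu)"
  using conj_tab_SYT[OF assms(2), of _ N]
  unfolding hspace_def conj_op_apply[OF assms(1)] by (auto intro!: sum.neutral)

lemma conj_op_ket:
  assumes "finite (SYT N lam)" "T \<in> SYT N lam"
  shows "conj_op N lam T0 (ket T) = of_int (tab_sign N T0 T) *\<^sub>c ket (conj_tab T)"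
proof
  fix b
  have "conj_op N lam T0 (ket T) b = (\<Sum>T'\<in>SYT N lam. if T' = T then
      (if b = conj_tab T then of_int (tab_sign N T0 T) else 0) else 0)"
    unfolding conj_op_apply[OF assms(1)] by (intro sum.cong) (auto simp: ket_def)
  then show "conj_op N lam T0 (ket T) b = (of_int (tab_sign N T0 T) *\<^sub>c ket (conj_tab T)) b"
    using assms by (simp add: cscale_def ket_def)
qed

lemma unitary_conj_op:
  assumes "finite (SYT N lam)" "diagram mu = prod.swap ` diagram lam"
  shows "unitary_op (SYT N lam) (SYT N mu) (conj_op N lam T0) \<and>
    adjoint_op (SYT N lam) (SYT N mu) (conj_op N lam T0) \<in> hspace (SYT N mu) \<rightarrow> hspace (SYT N lam)"
proof (rule unitary_op_monomial[OF assms(1) bij_betw_conj_tab[OF assms(2)]])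
  \<comment> \<open>A sign is real with square 1, hence a phase.\<close>
  show "cnj (of_int (tab_sign N T0 T)) * of_int (tab_sign N T0 T) = (1 :: complex)" for T
    by (simp add: tab_sign_def flip: of_int_mult)
qed (use assms in \<open>auto intro: conj_op_in_hspace simp: conj_op_conj_tab\<close>)

section \<open>The intertwining relation\<close>

lemma young_yamanouchi_ket:
  assumes "young_yamanouchi N lam D" "1 \<le> k" "k < N" "T \<in> SYT N lam"
    and "s = Transposition.transpose k (k + 1)" "r = real_of_int (axial_distance T (k + 1) k)"
  shows "D s (ket T) = complex_of_real (1 / r) *\<^sub>c ket T +
    (if s \<circ> T \<in> SYT N lam then complex_of_real (sqrt (1 - 1 / r\<^sup>2)) *\<^sub>c ket (s \<circ> T) else 0)"
  using assms unfolding young_yamanouchi_def Let_def by blast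

text \<open>On a ket with sign \<open>e\<close>, both sides have coefficient \<open>- e / r\<close>
  at the conjugate tableau. If \<open>s \<circ> T\<close> is standard, both have
  \<open>e * q\<close> at its conjugate: on the right the flipped sign of \<open>s \<circ> T\<close>
  cancels the factor -1.\<close>

lemma conj_op_intertwines_adjacent:
  assumes fin: "finite (SYT N lam)" and mu: "diagram mu = prod.swap ` diagram lam"
    and D: "young_yamanouchi N lam D" and D': "young_yamanouchi N mu D'"
    and T0: "T0 \<in> SYT N lam" and k: "1 \<le> k" "k < N"
    and v: "v \<in> hspace (SYT N lam)"
  defines "s \<equiv> Transposition.transpose k (k + 1)"
  shows "D' s (conj_op N lam T0 v) = (- 1) *\<^sub>c conj_op N lam T0 (D s v)"
proof -
  let ?U = "conj_op N lam T0" and ?S = "SYT N lam" and ?S' = "SYT N mu"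
  have s: "s permutes {1..N}" using k by (auto simp: s_def intro!: permutes_swap_id)
  have U: "linear_op ?S ?S' ?U"
    using unitary_conj_op[OF fin mu] by (simp add: unitary_op_def)
  have Ds: "linear_op ?S ?S (D s)" and Ds': "linear_op ?S' ?S' (D' s)"
    using D D' s by (auto simp: young_yamanouchi_def linear_rep_def sym_group_carrier)
  show ?thesis
  proof (rule linear_op_eqI[OF fin linear_op_compose[OF U Ds']
        linear_op_scaled[OF linear_op_compose[OF Ds U]] _ v])
    fix T assume T: "T \<in> ?S"
    define r where "r = real_of_int (axial_distance T (k + 1) k)"
    define q where "q = complex_of_real (sqrt (1 - 1 / r\<^sup>2))"
    define e where "e = (of_int (tab_sign N T0 T) :: complex)"
    have cT: "conj_tab T \<in> ?S'" using conj_tab_SYT[OF mu T] .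
    have "diagram lam = prod.swap ` diagram mu" unfolding mu by (auto simp: image_image)
    \<comment> \<open>Conjugation preserves standardness, so the off-diagonal term is present on
      both sides or on neither.\<close>
    then have iff: "s \<circ> conj_tab T \<in> ?S' \<longleftrightarrow> s \<circ> T \<in> ?S"
      using conj_tab_SYT[OF mu, of "s \<circ> T" N] conj_tab_SYT[of lam mu "s \<circ> conj_tab T" N]
      by (auto simp: conj_tab_comp)
    have r': "real_of_int (axial_distance (conj_tab T) (k + 1) k) = - r"
      using axial_distance_conj_tab[OF T, of "k + 1" k] k by (simp add: r_def)
    have DT: "D s (ket T) = complex_of_real (1 / r) *\<^sub>c ket T +
        (if s \<circ> T \<in> ?S then q *\<^sub>c ket (s \<circ> T) else 0)"
      unfolding q_def by (rule young_yamanouchi_ket[OF D k T s_def[THEN meta_eq_to_obj_eq] r_def])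
    \<comment> \<open>Replacing \<open>r\<close> by \<open>- r\<close> leaves \<open>q\<close>
      unchanged, as \<open>q\<close> involves only the square of \<open>r\<close>.\<close>
    have DcT: "D' s (ket (conj_tab T)) = complex_of_real (1 / (- r)) *\<^sub>c ket (conj_tab T) +
        (if s \<circ> T \<in> ?S then q *\<^sub>c ket (s \<circ> conj_tab T) else 0)"
      using young_yamanouchi_ket[OF D' k cT s_def[THEN meta_eq_to_obj_eq] r'[symmetric]]
      by (simp add: q_def iff)
    have lhs: "D' s (?U (ket T)) = e *\<^sub>c D' s (ket (conj_tab T))"
      using conj_op_ket[OF fin T] linear_op_cscale[OF Ds' ket_in_hspace[OF cT]]
      by (simp add: e_def)
    \<comment> \<open>\<open>k\<close> and \<open>k + 1\<close> differ, so \<open>s\<close> is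
      odd.\<close>
    have sign: "of_int (tab_sign N T0 (s \<circ> T)) = - e"
      using tab_sign_comp[OF T0 T s] by (simp add: s_def sign_swap_id e_def)
    have "?U (D s (ket T)) = complex_of_real (1 / r) *\<^sub>c e *\<^sub>c ket (conj_tab T) +
        (if s \<circ> T \<in> ?S then q *\<^sub>c (- e) *\<^sub>c ket (s \<circ> conj_tab T) else 0)"
    proof (cases "s \<circ> T \<in> ?S")
      case True
      have "?U (ket (s \<circ> T)) = (- e) *\<^sub>c ket (s \<circ> conj_tab T)"
        using conj_op_ket[OF fin True, of T0] by (simp add: sign conj_tab_comp)
      then show ?thesis
        using True T conj_op_ket[OF fin T, of T0]
        by (simp add: DT linear_op_add[OF U] linear_op_cscale[OF U] hspace_cscale
            ket_in_hspace e_def)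
    next
      case False
      then show ?thesis
        using T conj_op_ket[OF fin T, of T0]
        by (simp add: DT linear_op_cscale[OF U] ket_in_hspace e_def)
    qed
    then show "D' s (?U (ket T)) = (- 1) *\<^sub>c ?U (D s (ket T))"
      unfolding lhs DcT by (auto simp: cscale_def fun_eq_iff algebra_simps)
  qed
qed

text \<open>Both representations are multiplicative, and each adjacent factor contributes -1, just
  as it does to the sign of the permutation. The adjoint is avoided here and enters only in the
  final theorem.\<close>

lemma conj_op_intertwines:
  assumes fin: "finite (SYT N lam)" and mu: "diagram mu = prod.swap ` diagram lam"
    and D: "young_yamanouchi N lam D" and D': "young_yamanouchi N mu D'"
    and T0: "T0 \<in> SYT N lam" and \<pi>: "\<pi> permutes {1..N}"
    and v: "v \<in> hspace (SYT N lam)"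
  shows "D' \<pi> (conj_op N lam T0 v) = of_int (sign \<pi>) *\<^sub>c conj_op N lam T0 (D \<pi> v)"
  using \<pi> v
proof (induction arbitrary: v rule: permutes_adjacent_induct)
  case id
  interpret A: group_action "sym_group N" "hspace (SYT N lam)" D
    using D by (simp add: young_yamanouchi_def linear_rep_def)
  interpret A': group_action "sym_group N" "hspace (SYT N mu)" D'
    using D' by (simp add: young_yamanouchi_def linear_rep_def)
  \<comment> \<open>A group action sends the unit to the identity restricted to the space, so
    membership of both vectors is used.\<close>
  have "D id v = v" "D' id (conj_op N lam T0 v) = conj_op N lam T0 v"
    using fun_cong[OF A.id_eq_one, of v] fun_cong[OF A'.id_eq_one, of "conj_op N lam T0 v"]
      id conj_op_in_hspace[OF fin mu, of T0 v]
    by (simp_all add: sym_group_one)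
  then show ?case by (simp add: cscale_def del: id_apply)
next
  case (adj k q)
  let ?U = "conj_op N lam T0"
  interpret A: group_action "sym_group N" "hspace (SYT N lam)" D
    using D by (simp add: young_yamanouchi_def linear_rep_def)
  interpret A': group_action "sym_group N" "hspace (SYT N mu)" D'
    using D' by (simp add: young_yamanouchi_def linear_rep_def)
  define s where "s = Transposition.transpose k (k + 1)"
  have s: "s permutes {1..N}" using adj(1,2) by (auto simp: s_def intro!: permutes_swap_id)
  have Dqv: "D q v \<in> hspace (SYT N lam)"
    using A.element_image[of q v] adj by (auto simp: sym_group_carrier)
  have sq: "sign (s \<circ> q) = - sign q"
    using sign_compose[of s q] permutes_imp_permutation[OF _ s] permutes_imp_permutation[OF _ adj(3)]
    by (simp add: s_def sign_swap_id)
  have "D' (s \<circ> q) (?U v) = D' s (D' q (?U v))"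
    using A'.composition_rule[of "?U v" s q] s adj(3) conj_op_in_hspace[OF fin mu]
    by (simp add: sym_group_carrier sym_group_mult)
  also have "\<dots> = D' s (of_int (sign q) *\<^sub>c ?U (D q v))"
    using adj by simp
  also have "\<dots> = of_int (sign q) *\<^sub>c D' s (?U (D q v))"
    using D' s conj_op_in_hspace[OF fin mu]
    by (intro linear_op_cscale) (auto simp: young_yamanouchi_def linear_rep_def sym_group_carrier)
  \<comment> \<open>The adjacent case is applied to the vector \<open>D q v\<close>, which the
    action keeps in the space.\<close>
  also have "\<dots> = of_int (sign q) *\<^sub>c (- 1) *\<^sub>c ?U (D s (D q v))"
    unfolding s_def using conj_op_intertwines_adjacent[OF fin mu D D' T0 adj(1,2) Dqv] by simp
  also have "D s (D q v) = D (s \<circ> q) v"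
    using A.composition_rule[of v s q] s adj(3,5)
    by (simp add: sym_group_carrier sym_group_mult)
  also have "of_int (sign q) *\<^sub>c (- 1) *\<^sub>c ?U (D (s \<circ> q) v) =
      of_int (sign (s \<circ> q)) *\<^sub>c ?U (D (s \<circ> q) v)"
    unfolding sq by (simp add: cscale_def)
  finally show ?case
    unfolding s_def .
qed

section \<open>Unitarity, the conjugation formula and the global sign\<close>

theorem propositionV17:
  fixes N :: nat and lam :: "nat \<Rightarrow> nat"
    and D D' :: "(nat \<Rightarrow> nat) \<Rightarrow> (tableau \<Rightarrow> complex) \<Rightarrow> tableau \<Rightarrow> complex"
  assumes "N \<ge> 1"
    and "partition_of N lam"
    and "young_yamanouchi N lam D"
    and "young_yamanouchi N (conjugate lam) D'"
  shows "(\<forall>T0\<in>SYT N lam.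
            unitary_op (SYT N lam) (SYT N (conjugate lam)) (conj_op N lam T0) \<and>
            (\<forall>\<pi>\<in>carrier (sym_group N). \<forall>w\<in>hspace (SYT N (conjugate lam)).
               D' \<pi> w = of_int (sign \<pi>) *\<^sub>c conj_op N lam T0 (D \<pi>
                 (adjoint_op (SYT N lam) (SYT N (conjugate lam)) (conj_op N lam T0) w)))) \<and>
         (\<forall>T0\<in>SYT N lam. \<forall>T1\<in>SYT N lam. \<exists>c\<in>{1, - 1 :: complex}.
            \<forall>v\<in>hspace (SYT N lam). conj_op N lam T1 v = c *\<^sub>c conj_op N lam T0 v)"
proof (intro conjI ballI)
  note fin = finite_SYT[OF assms(2)] and mu = diagram_conjugate[OF assms(2)]
  fix T0 assume T0: "T0 \<in> SYT N lam"
  let ?S = "SYT N lam" and ?S' = "SYT N (conjugate lam)" and ?U = "conj_op N lam T0"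
  show un: "unitary_op ?S ?S' ?U"
    using unitary_conj_op[OF fin mu] by blast
  {
    fix \<pi> w assume \<pi>: "\<pi> \<in> carrier (sym_group N)" and w: "w \<in> hspace ?S'"
    \<comment> \<open>Writing \<open>w\<close> as the image under \<open>?U\<close> of its adjoint
      image turns the intertwining relation into the conjugation formula.\<close>
    have "?U (adjoint_op ?S ?S' ?U w) = w"
      using un w by (simp add: unitary_op_def)
    moreover have "adjoint_op ?S ?S' ?U w \<in> hspace ?S"
      using unitary_conj_op[OF fin mu] w by blast
    moreover have "\<pi> permutes {1..N}"
      using \<pi> by (simp only: sym_group_carrier)
    ultimately show "D' \<pi> w = of_int (sign \<pi>) *\<^sub>c ?U (D \<pi> (adjoint_op ?S ?S' ?U w))"
      using conj_op_intertwines[OF fin mu assms(3,4) T0] by metis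
  }
  fix T1 assume T1: "T1 \<in> ?S"
  show "\<exists>c\<in>{1, - 1 :: complex}. \<forall>v\<in>hspace ?S. conj_op N lam T1 v = c *\<^sub>c ?U v"
  proof (intro bexI ballI)
    \<comment> \<open>The global sign is that of the permutation carrying \<open>T1\<close> to
      \<open>T0\<close>.\<close>
    show "complex_of_int (tab_sign N T1 T0) \<in> {1, - 1}"
      by (cases rule: sign_cases) (auto simp: tab_sign_def sign_def)
    fix v
    have "of_int (tab_sign N T1 T) = (of_int (tab_sign N T1 T0) * of_int (tab_sign N T0 T) :: complex)"
      if "T \<in> ?S" for T
      using tab_sign_change_base[OF T0 T1 that] by simp
    then show "conj_op N lam T1 v = of_int (tab_sign N T1 T0) *\<^sub>c ?U v"
      by (intro ext) (simp add: conj_op_apply[OF fin] cscale_def sum_distrib_left if_distrib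
          mult.assoc cong: if_cong)
  qed
qed

end
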